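(* Let $k\geq 1$, let $w$ be an infinite word over $[k]$, let $d,L\ge0$ be integers, and let $w'$ be a word over $[k]$ of length at least $L$. For $0\le \ell<L$ let \[ A[\ell]=\{\,i\in\{0,1,\dots,d\}: w[P_i(\ell)]=w'[\ell]\,\}, \] and denote by the same letter $A[\ell]$ the word over $\{0,1,\dots,d\}$ obtained by writing the elements of the set $A[\ell]$ in decreasing order. Then the concatenated word $A[0]A[1]\cdots A[L-1]$ satisfies \[ \mathrm{LNDS}_i\bigl(A[0]A[1]\cdots A[L-1]\bigr)=P_i(L)-i\qquad\text{for every } i\in\{0,1,\dots,d\}. \]
   Context: Let $[k]=\{1,\dots,k\}$. Symbols of a word $u$ are indexed from $0$: $u=u[0]u[1]u[2]\cdots$; $u_{<m}$ denotes the prefix of $u$ of length $m$. A subsequence of a word is obtained by deleting some (not necessarily contiguous) symbols. For words $u,u'$ and an integer $i\ge 0$, write $u\prec_i u'$ if one can remove at most $i$ symbols from $u$ and obtain a subsequence of $u'$. For the given $w,w'$ and integers $i\geq 0$ and $0\le \ell\le \operatorname{len}(w')$, \[ P_i(\ell)=\max\{m : w_{<m}\prec_i w'_{<\ell}\}. \] A word $u$ over integers is non-decreasing if $u[j]\le u[j+1]$ for all $j$; $\mathrm{LNDS}(u)$ is the length of the longest non-decreasing subsequence of $u$; and $\mathrm{LNDS}_i(u)=\mathrm{LNDS}(u|_i)$, where $u|_i$ is obtained from $u$ by deleting all symbols greater than $i$. *)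

theory Defs
  imports Main "HOL-Library.Sublist"
begin

definition take_word :: "nat \<Rightarrow> (nat \<Rightarrow> 'a) \<Rightarrow> 'a list" where
  "take_word m w = map w [0..<m]"

definition subseq_del :: "nat \<Rightarrow> 'a list \<Rightarrow> 'a list \<Rightarrow> bool" where
  "subseq_del i u u' \<longleftrightarrow> (\<exists>v. subseq v u \<and> length u - length v \<le> i \<and> subseq v u')"

definition P :: "(nat \<Rightarrow> 'a) \<Rightarrow> 'a list \<Rightarrow> nat \<Rightarrow> nat \<Rightarrow> nat" where
  "P w w' i l = Max {m. subseq_del i (take_word m w) (take l w')}"

definition LNDS :: "'a::linorder list \<Rightarrow> nat" where
  "LNDS u = Max {length v | v. subseq v u \<and> sorted v}"

definition LNDS_upto :: "'a::linorder \<Rightarrow> 'a list \<Rightarrow> nat" where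
  "LNDS_upto i u = LNDS (filter (\<lambda>x. x \<le> i) u)"

definition A_set :: "(nat \<Rightarrow> 'a) \<Rightarrow> 'a list \<Rightarrow> nat \<Rightarrow> nat \<Rightarrow> nat set" where
  "A_set w w' d l = {i \<in> {0..d}. w (P w w' i l) = w' ! l}"

definition A_word :: "(nat \<Rightarrow> 'a) \<Rightarrow> 'a list \<Rightarrow> nat \<Rightarrow> nat \<Rightarrow> nat list" where
  "A_word w w' d l = rev (sorted_list_of_set (A_set w w' d l))"

text \<open>The maxima defining \<^const>\<open>P\<close> and \<^const>\<open>LNDS\<close> range over finite nonempty sets, and
  the difference \<open>P\<^sub>i(l) - i\<close> is never negative.\<close>

lemma P_set:
  shows "finite {m. subseq_del i (take_word m w) (take l w')}"
    and "i \<in> {m. subseq_del i (take_word m w) (take l w')}"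
proof -
  have "{m. subseq_del i (take_word m w) (take l w')} \<subseteq> {..length w' + i}"
  proof
    fix m assume "m \<in> {m. subseq_del i (take_word m w) (take l w')}"
    then obtain v where "m - length v \<le> i" "subseq v (take l w')"
      by (auto simp: subseq_del_def take_word_def)
    moreover from this(2) have "length v \<le> length (take l w')"
      by (rule list_emb_length)
    ultimately show "m \<in> {..length w' + i}" by auto
  qed
  then show "finite {m. subseq_del i (take_word m w) (take l w')}"
    by (rule finite_subset) simp
  show "i \<in> {m. subseq_del i (take_word m w) (take l w')}"
    by (auto simp: subseq_del_def take_word_def intro!: exI[of _ "[]"])
qed

lemma P_ge: "i \<le> P w w' i l"
  unfolding P_def by (rule Max_ge[OF P_set])

lemma LNDS_set:
  shows "finite {length v | v. subseq v u \<and> sorted v}"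
    and "0 \<in> {length v | v. subseq v u \<and> sorted v}"
proof -
  have "{length v | v. subseq v u \<and> sorted v} \<subseteq> {..length u}"
    by (auto dest: list_emb_length)
  then show "finite {length v | v. subseq v u \<and> sorted v}"
    by (rule finite_subset) simp
  show "0 \<in> {length v | v. subseq v u \<and> sorted v}"
    by (auto intro!: exI[of _ "[]"])
qed

end

theory Submission
  imports Defs
begin

text \<open>Put \<open>f\<^sub>i(l) = P\<^sub>i(l) - i\<close>; it is non-decreasing in \<open>i\<close>. Passing from \<open>l\<close> to \<open>l + 1\<close> raises
  \<open>f\<^sub>i\<close> by one exactly if some \<open>j \<le> i\<close> in \<open>A[l]\<close> has \<open>f\<^sub>j(l) = f\<^sub>i(l)\<close>, and leaves it unchanged otherwise:
  a longer prefix is matched by extending an optimal \<open>j\<close>-deletion matching by \<open>w'[l]\<close> and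
  deleting the next \<open>i - j\<close> symbols. A non-decreasing subsequence uses at most one symbol of the
  decreasing word \<open>A[l]\<close>, so \<open>LNDS\<^sub>i\<close> of the growing concatenation obeys the same recursion,
  and both quantities start at \<open>0\<close>.\<close>

section \<open>Non-decreasing subsequences of a growing word\<close>

lemma subseq_snoc_cases:
  assumes "subseq v (u @ [b])"
  obtains "subseq v u" | v' where "v = v' @ [b]" "subseq v' u"
proof -
  from assms obtain v1 v2 where v: "v = v1 @ v2" "subseq v1 u" "subseq v2 [b]"
    by (auto simp: subseq_append_iff)
  from v(3) have "v2 = [] \<or> v2 = [b]"
    by (cases v2) (auto split: if_splits)
  with v that show thesis by auto
qed

text \<open>Trades the filter inside \<open>LNDS_upto\<close> for a bound on the symbols of
  \<open>v\<close>, the form used by the witness and the lower bound below.\<close>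

lemma subseq_filter_iff:
  "subseq v (filter Q u) \<longleftrightarrow> subseq v u \<and> (\<forall>y\<in>set v. Q y)"
proof
  assume *: "subseq v (filter Q u)"
  have "subseq v u" using * subseq_filter_left by (rule subseq_order.trans)
  moreover have "Q y" if "y \<in> set v" for y
    using list_emb_set[OF * that] by auto
  ultimately show "subseq v u \<and> (\<forall>y\<in>set v. Q y)" by simp
next
  assume *: "subseq v u \<and> (\<forall>y\<in>set v. Q y)"
  then have "subseq (filter Q v) (filter Q u)" by (blast intro: subseq_filter)
  with * show "subseq v (filter Q u)" by (simp add: filter_True)
qed

lemma LNDS_upto_witness:
  obtains v where "subseq v u" "sorted v" "\<forall>y\<in>set v. y \<le> i" "length v = LNDS_upto i u"
proof -
  have "LNDS_upto i u \<in> {length v | v. subseq v (filter (\<lambda>x. x \<le> i) u) \<and> sorted v}"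
    unfolding LNDS_upto_def LNDS_def using LNDS_set by (intro Max_in) blast+
  then show thesis using that by (auto simp: subseq_filter_iff)
qed

lemma LNDS_upto_ge:
  assumes "subseq v u" "sorted v" "\<forall>y\<in>set v. y \<le> i"
  shows "length v \<le> LNDS_upto i u"
  unfolding LNDS_upto_def LNDS_def using assms
  by (intro Max_ge[OF LNDS_set(1)]) (auto simp: subseq_filter_iff)

lemma LNDS_upto_mono:
  assumes "i \<le> j"
  shows "LNDS_upto i u \<le> LNDS_upto j u"
proof -
  obtain v where "subseq v u" "sorted v" "\<forall>y\<in>set v. y \<le> i" "length v = LNDS_upto i u"
    by (rule LNDS_upto_witness)
  with assms LNDS_upto_ge[of v u j] show ?thesis by fastforce
qed

text \<open>A non-decreasing subsequence that uses the new \<open>x\<close> has only symbols at most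
  \<open>x\<close> before it, so its remainder is measured by \<open>LNDS_upto x u\<close>.\<close>

lemma LNDS_upto_snoc:
  "LNDS_upto i (u @ [x]) =
     (if x \<le> i then max (LNDS_upto i u) (LNDS_upto x u + 1) else LNDS_upto i u)"
proof (cases "x \<le> i")
  case False
  then show ?thesis by (simp add: LNDS_upto_def)
next
  case True
  have "LNDS_upto i (u @ [x]) \<le> max (LNDS_upto i u) (LNDS_upto x u + 1)"
  proof -
    obtain v where v: "subseq v (u @ [x])" "sorted v" "\<forall>y\<in>set v. y \<le> i"
        "length v = LNDS_upto i (u @ [x])"
      by (rule LNDS_upto_witness)
    from v(1) show ?thesis
    proof (cases rule: subseq_snoc_cases)
      case 1
      with LNDS_upto_ge[of v u i] v show ?thesis by simp
    next
      case (2 v')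
      with LNDS_upto_ge[of v' u x] v show ?thesis by (auto simp: sorted_append)
    qed
  qed
  moreover have "LNDS_upto i u \<le> LNDS_upto i (u @ [x])"
  proof -
    obtain v where "subseq v u" "sorted v" "\<forall>y\<in>set v. y \<le> i" "length v = LNDS_upto i u"
      by (rule LNDS_upto_witness)
    with LNDS_upto_ge[of v "u @ [x]" i] show ?thesis
      by (simp add: subseq_rev_drop_many)
  qed
  moreover have "LNDS_upto x u + 1 \<le> LNDS_upto i (u @ [x])"
  proof -
    obtain v where "subseq v u" "sorted v" "\<forall>y\<in>set v. y \<le> x" "length v = LNDS_upto x u"
      by (rule LNDS_upto_witness)
    moreover from this(3) True have "\<forall>y\<in>set v. y \<le> i" by auto
    ultimately show ?thesis
      using True LNDS_upto_ge[of "v @ [x]" "u @ [x]" i] by (simp add: sorted_append)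
  qed
  ultimately show ?thesis using True by simp
qed

text \<open>Peel off the last, smallest symbol \<open>x\<close>. All earlier symbols of
  \<open>xs\<close> exceed \<open>x\<close>, so they leave \<open>LNDS_upto x\<close> unchanged; by
  monotonicity \<open>x\<close> can then lift the value at \<open>i\<close> to at most one above
  \<open>LNDS_upto i u\<close>.\<close>

lemma LNDS_upto_append_decreasing:
  assumes "sorted_wrt (>) xs"
  shows "LNDS_upto i (u @ xs) =
    LNDS_upto i u + of_bool (\<exists>x\<in>set xs. x \<le> i \<and> LNDS_upto x u = LNDS_upto i u)"
  using assms
proof (induction xs arbitrary: i rule: rev_induct)
  case Nil
  then show ?case by simp
next
  case (snoc x xs)
  then have sx: "sorted_wrt (>) xs" and gt: "\<forall>y\<in>set xs. x < y"
    by (auto simp: sorted_wrt_append)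
  have x: "LNDS_upto x (u @ xs) = LNDS_upto x u"
    using snoc.IH[OF sx, of x] gt by auto
  have "LNDS_upto x u \<le> LNDS_upto i u" if "x \<le> i"
    using that by (rule LNDS_upto_mono)
  then show ?case
    using snoc.IH[OF sx, of i] x LNDS_upto_snoc[of i "u @ xs" x] by auto
qed

section \<open>Prefix matching with deletions\<close>

lemma subseq_del_append_left:
  assumes "subseq_del i u x"
  shows "subseq_del (i + length v) (u @ v) x"
proof -
  from assms obtain s where "subseq s u" "length u - length s \<le> i" "subseq s x"
    by (auto simp: subseq_del_def)
  then show ?thesis
    unfolding subseq_del_def by (intro exI[of _ s]) auto
qed

lemma subseq_del_append_right:
  assumes "subseq_del i u x"
  shows "subseq_del i u (x @ y)"
  using assms unfolding subseq_del_def by auto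

lemma subseq_del_snoc_snoc:
  assumes "subseq_del i u x"
  shows "subseq_del i (u @ [a]) (x @ [a])"
proof -
  from assms obtain s where "subseq s u" "length u - length s \<le> i" "subseq s x"
    by (auto simp: subseq_del_def)
  then show ?thesis
    unfolding subseq_del_def by (intro exI[of _ "s @ [a]"]) auto
qed

lemma subseq_del_snoc_cases:
  assumes "subseq_del i (u @ [b]) (x @ [a])"
  obtains "subseq_del i (u @ [b]) x"
    | "a = b" "subseq_del i u x"
    | i' where "i = Suc i'" "subseq_del i' u (x @ [a])"
proof -
  from assms obtain s where s: "subseq s (u @ [b])" "Suc (length u) - length s \<le> i"
      "subseq s (x @ [a])"
    by (auto simp: subseq_del_def)
  from s(1) show thesis
  proof (cases rule: subseq_snoc_cases)
    case 1
    then have "length s \<le> length u" by (rule list_emb_length)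
    with s(2) obtain i' where "i = Suc i'" "length u - length s \<le> i'"
      by (cases i) auto
    with 1 s(3) that(3) show thesis by (auto simp: subseq_del_def)
  next
    case (2 s')
    from s(3) show thesis
    proof (cases rule: subseq_snoc_cases)
      case 1
      with s that(1) show thesis by (auto simp: subseq_del_def)
    next
      case (2 s'')
      with \<open>s = s' @ [b]\<close> \<open>subseq s' u\<close> s(2) that(2) show thesis
        by (auto simp: subseq_del_def)
    qed
  qed
qed

lemma take_word_Suc: "take_word (Suc m) w = take_word m w @ [w m]"
  by (simp add: take_word_def)

lemma take_word_add:
  "take_word (m + n) w = take_word m w @ map w [m..<m + n]"
  by (simp add: take_word_def upt_add_eq_append[of 0 m n, simplified])

lemma le_P:
  assumes "subseq_del i (take_word m w) (take l w')"
  shows "m \<le> P w w' i l"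
  unfolding P_def using P_set(1) assms by (intro Max_ge) auto

lemma subseq_del_P: "subseq_del i (take_word (P w w' i l) w) (take l w')"
proof -
  have "P w w' i l \<in> {m. subseq_del i (take_word m w) (take l w')}"
    unfolding P_def using P_set by (intro Max_in) blast+
  then show ?thesis by simp
qed

text \<open>The \<open>t\<close> extra deletions are spent on the next \<open>t\<close> symbols of
  \<open>w\<close>. This is the monotonicity of \<open>f_i(l)\<close> in \<open>i\<close>.\<close>

lemma P_add_le: "P w w' i l + t \<le> P w w' (i + t) l"
  using subseq_del_append_left[OF subseq_del_P[of i w w' l],
      of "map w [P w w' i l..<P w w' i l + t]"]
  by (intro le_P) (simp add: take_word_add)

lemma P_zero: "P w w' i 0 = i"
proof (rule antisym)
  show "P w w' i 0 \<le> i"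
    using subseq_del_P[of i w w' 0] by (auto simp: subseq_del_def take_word_def dest: list_emb_length)
qed (rule P_ge)

text \<open>The equation \<open>P\<^sub>j(l) + i = P\<^sub>i(l) + j\<close> is \<open>f\<^sub>j(l) = f\<^sub>i(l)\<close> without subtraction.\<close>

lemma P_Suc:
  assumes l: "l < length w'"
  shows "P w w' i (Suc l) = P w w' i l +
    of_bool (\<exists>j\<le>i. w (P w w' j l) = w' ! l \<and> P w w' j l + i = P w w' i l + j)"
    (is "_ = _ + of_bool (?B i)")
proof (rule antisym)
  have t: "take (Suc l) w' = take l w' @ [w' ! l]"
    using l by (rule take_Suc_conv_app_nth)
  \<comment> \<open>The bound is proved for all \<open>i\<close> at once, because deleting the last
    symbol of the prefix passes to one deletion fewer.\<close>
  have "m \<le> P w w' i l + of_bool (?B i)"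
    if "subseq_del i (take_word m w) (take l w' @ [w' ! l])" for m
    using that
  proof (induction m arbitrary: i)
    case 0
    then show ?case by simp
  next
    case (Suc m)
    from Suc.prems show ?case
      unfolding take_word_Suc
    proof (cases rule: subseq_del_snoc_cases)
      case 1
      then have "Suc m \<le> P w w' i l" by (intro le_P) (simp add: take_word_Suc)
      then show ?thesis by simp
    next
      case 2
      from 2(2) have "m \<le> P w w' i l" by (rule le_P)
      \<comment> \<open>Here \<open>j = i\<close> is the witness.\<close>
      moreover have "?B i" if "m = P w w' i l" using that 2(1) by auto
      ultimately show ?thesis by (cases "m = P w w' i l") auto
    next
      case (3 i')
      have IH: "m \<le> P w w' i' l + of_bool (?B i')" using 3(2) by (rule Suc.IH)
      have le: "P w w' i' l + 1 \<le> P w w' i l"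
        using P_add_le[of w w' i' l 1] 3(1) by simp
      show ?thesis
      \<comment> \<open>If \<open>f_i'(l) = f_i(l)\<close>, a witness for \<open>i'\<close> also
        serves \<open>i\<close>. Otherwise either there is no increment at \<open>i'\<close>, or the
        strict inequality \<open>f_i'(l) < f_i(l)\<close> absorbs it.\<close>
      proof (cases "?B i' \<and> P w w' i' l + 1 = P w w' i l")
        case True
        then obtain j where "j \<le> i'" "w (P w w' j l) = w' ! l"
            "P w w' j l + i' = P w w' i' l + j" by blast
        with True 3(1) have "?B i" by (intro exI[of _ j]) auto
        with True IH le show ?thesis by simp
      next
        case False
        with IH le have "Suc m \<le> P w w' i l" by (cases "?B i'") simp_all
        then show ?thesis by simp
      qed
    qed
  qed
  then show "P w w' i (Suc l) \<le> P w w' i l + of_bool (?B i)"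
    using subseq_del_P[of i w w' "Suc l"] by (simp only: t)
next
  have t: "take (Suc l) w' = take l w' @ [w' ! l]"
    using l by (rule take_Suc_conv_app_nth)
  show "P w w' i l + of_bool (?B i) \<le> P w w' i (Suc l)"
  proof (cases "?B i")
    case True
    then obtain j where j: "j \<le> i" "w (P w w' j l) = w' ! l"
        "P w w' j l + i = P w w' i l + j" by blast
    have "subseq_del j (take_word (Suc (P w w' j l)) w) (take (Suc l) w')"
      using subseq_del_snoc_snoc[OF subseq_del_P[of j w w' l], of "w' ! l"] j(2)
      by (simp add: t take_word_Suc)
    then have "Suc (P w w' j l) \<le> P w w' j (Suc l)" by (rule le_P)
    \<comment> \<open>The remaining \<open>i - j\<close> deletions extend the matched prefix beyond
      the symbol just gained.\<close>
    with P_add_le[of w w' j "Suc l" "i - j"] j True show ?thesis by simp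
  next
    case False
    have "P w w' i l \<le> P w w' i (Suc l)"
      unfolding t using subseq_del_append_right[OF subseq_del_P[of i w w' l]]
      by (intro le_P) (simp add: t)
    moreover have "of_bool (?B i) = (0::nat)" using False by (simp only: of_bool_eq)
    ultimately show ?thesis by linarith
  qed
qed

section \<open>Comparison of the two recursions\<close>

lemma A_word_decreasing: "sorted_wrt (>) (A_word w w' d l)"
  by (simp add: A_word_def sorted_wrt_rev)

lemma set_A_word: "set (A_word w w' d l) = {i. i \<le> d \<and> w (P w w' i l) = w' ! l}"
  by (auto simp: A_word_def A_set_def)

text \<open>Induction on \<open>L\<close> with \<open>i\<close> general, since the increment at
  \<open>i\<close> depends on the values at all \<open>j \<le> i\<close>. Adding \<open>i\<close> on
  the left avoids truncated subtraction.\<close>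

lemma LNDS_upto_A_words:
  assumes "L \<le> length w'" "i \<le> d"
  shows "LNDS_upto i (concat (map (A_word w w' d) [0..<L])) + i = P w w' i L"
  using assms
proof (induction L arbitrary: i)
  case 0
  have "LNDS_upto i [] = 0"
    using LNDS_upto_witness[of "[]" i] by (metis list_emb_length le_zero_eq list.size(3))
  then show ?case by (simp add: P_zero)
next
  case (Suc l)
  let ?u = "concat (map (A_word w w' d) [0..<l])"
  have IH: "LNDS_upto j ?u + j = P w w' j l" if "j \<le> i" for j
    using Suc that by simp
  \<comment> \<open>The two increment conditions agree: the induction hypothesis translates the
    equalities, and \<open>i \<le> d\<close> ensures that the cutoff at \<open>d\<close> loses no
    candidate \<open>j \<le> i\<close>.\<close>
  have "(\<exists>x\<in>set (A_word w w' d l). x \<le> i \<and> LNDS_upto x ?u = LNDS_upto i ?u) \<longleftrightarrow>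
    (\<exists>j\<le>i. w (P w w' j l) = w' ! l \<and> P w w' j l + i = P w w' i l + j)"
  proof -
    have "LNDS_upto x ?u = LNDS_upto i ?u \<longleftrightarrow> P w w' x l + i = P w w' i l + x"
      if "x \<le> i" for x
      using IH[OF that] IH[of i] by auto
    then show ?thesis
      unfolding set_A_word using Suc.prems(2) by (smt (verit) mem_Collect_eq le_trans)
  qed
  with LNDS_upto_append_decreasing[OF A_word_decreasing, of i ?u w w' d l]
    P_Suc[of l w' w i] IH[of i] Suc.prems(1)
  show ?case by simp
qed

theorem proposition7:
  fixes k d L :: nat and w :: "nat \<Rightarrow> nat" and w' :: "nat list"
  assumes "k \<ge> 1"
    and "\<And>n. w n \<in> {1..k}"
    and "set w' \<subseteq> {1..k}"
    and "L \<le> length w'"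
  shows "\<forall>i\<in>{0..d}. int (LNDS_upto i (concat (map (A_word w w' d) [0..<L])))
           = int (P w w' i L) - int i"
proof
  fix i assume "i \<in> {0..d}"
  with LNDS_upto_A_words[of L w' i d w] assms(4)
  show "int (LNDS_upto i (concat (map (A_word w w' d) [0..<L]))) = int (P w w' i L) - int i"
    by simp
qed

end
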